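(* Let $n,m,\ell$ be integers with $1\leq \ell+1\leq m\leq n$. Let $X_1,X_2,\ldots,X_n$ be independent Bernoulli random variables with $P(X_i=1)=1-P(X_i=0)=p_i\in(0,1)$ for $1\leq i\leq n$. Let $$R=R\left(\min_{i:1\leq i\leq m}X_i,\ \min_{j:\ell+1\leq j\leq n}X_j\right)$$ be the maximal correlation coefficient of the two minima. Then $$R=\frac{\prod_{i=1}^{n}p_i-\left(\prod_{i=1}^{m}p_i\right)\left(\prod_{i=\ell+1}^{n}p_i\right)}{\sqrt{\left(\prod_{i=1}^{m}p_i\right)\left(1-\prod_{i=1}^{m}p_i\right)\left(\prod_{i=\ell+1}^{n}p_i\right)\left(1-\prod_{i=\ell+1}^{n}p_i\right)}}.$$ In particular, if $p_1=p_2=\cdots=p_n=p\in(0,1)$, then $R=R_{m,\ell}(p)$, where $$R_{m,\ell}(p):=\frac{p^n-p^{m+n-\ell}}{\sqrt{p^{m+n-\ell}(1-p^m)(1-p^{n-\ell})}}.$$ Moreover, for fixed $n,m,\ell$, the function $p\mapsto R_{m,\ell}(p)$ is non-decreasing on $(0,1)$.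
   Context: For two non-degenerate random variables $X$ and $Y$ on the same probability space, the maximal correlation coefficient is $$R(X,Y)=\sup\frac{\operatorname{Cov}(\varphi(X),\psi(Y))}{\sqrt{\operatorname{Var}(\varphi(X))\operatorname{Var}(\psi(Y))}},$$ where the supremum is over all (real-valued) measurable functions $\varphi$ and $\psi$ such that $\operatorname{Var}(\varphi(X)),\operatorname{Var}(\psi(Y))\in(0,\infty)$. *)

theory Defs
  imports "HOL-Probability.Probability"
begin

definition covariance :: "'a measure \<Rightarrow> ('a \<Rightarrow> real) \<Rightarrow> ('a \<Rightarrow> real) \<Rightarrow> real" where
  "covariance M U V =
     prob_space.expectation M (\<lambda>\<omega>. (U \<omega> - prob_space.expectation M U) * (V \<omega> - prob_space.expectation M V))"

(* The Bochner integral of a non-integrable function is 0, so Var(U) < infinity has to be stated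
   separately; on a probability space it amounts to U being measurable with integrable square. *)
definition positive_finite_variance :: "'a measure \<Rightarrow> ('a \<Rightarrow> real) \<Rightarrow> bool" where
  "positive_finite_variance M U \<longleftrightarrow>
     U \<in> borel_measurable M \<and> integrable M (\<lambda>\<omega>. (U \<omega>)\<^sup>2) \<and> prob_space.variance M U > 0"

(* For non-degenerate random variables the set below is non-empty, and by the Cauchy-Schwarz
   inequality it is bounded above by 1 (max_corr_quotient_le_1), so the real-valued supremum
   is the genuine one. *)
definition maximal_correlation :: "'a measure \<Rightarrow> ('a \<Rightarrow> real) \<Rightarrow> ('a \<Rightarrow> real) \<Rightarrow> real" where
  "maximal_correlation M X Y =
     Sup {covariance M (\<lambda>\<omega>. \<phi> (X \<omega>)) (\<lambda>\<omega>. \<psi> (Y \<omega>)) /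
            sqrt (prob_space.variance M (\<lambda>\<omega>. \<phi> (X \<omega>)) * prob_space.variance M (\<lambda>\<omega>. \<psi> (Y \<omega>)))
          | \<phi> \<psi>. \<phi> \<in> borel_measurable borel \<and> \<psi> \<in> borel_measurable borel \<and>
                  positive_finite_variance M (\<lambda>\<omega>. \<phi> (X \<omega>)) \<and>
                  positive_finite_variance M (\<lambda>\<omega>. \<psi> (Y \<omega>))}"

lemma max_corr_quotient_le_1:
  assumes "prob_space M" "positive_finite_variance M U" "positive_finite_variance M V"
  shows "covariance M U V / sqrt (prob_space.variance M U * prob_space.variance M V) \<le> 1"
proof -
  interpret prob_space M by fact
  have mU [measurable]: "U \<in> borel_measurable M" and iU: "integrable M (\<lambda>\<omega>. (U \<omega>)\<^sup>2)" and vU: "variance U > 0"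
    and mV [measurable]: "V \<in> borel_measurable M" and iV: "integrable M (\<lambda>\<omega>. (V \<omega>)\<^sup>2)" and vV: "variance V > 0"
    using assms by (auto simp: positive_finite_variance_def)
  define u where "u = (\<lambda>\<omega>. U \<omega> - expectation U)"
  define v where "v = (\<lambda>\<omega>. V \<omega> - expectation V)"
  have [measurable]: "u \<in> borel_measurable M" "v \<in> borel_measurable M"
    by (auto simp: u_def v_def)
  have iU1: "integrable M U" and iV1: "integrable M V"
    using square_integrable_imp_integrable[OF mU iU] square_integrable_imp_integrable[OF mV iV] by auto
  have iu: "integrable M (\<lambda>\<omega>. (u \<omega>)\<^sup>2)" and iv: "integrable M (\<lambda>\<omega>. (v \<omega>)\<^sup>2)"
    using iU iV iU1 iV1 by (auto simp: u_def v_def power2_diff)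
  define a where "a = sqrt (variance U)"
  define b where "b = sqrt (variance V)"
  have ab: "a > 0" "b > 0" using vU vV by (auto simp: a_def b_def)
  have a2: "expectation (\<lambda>\<omega>. (u \<omega>)\<^sup>2) = a\<^sup>2" and b2: "expectation (\<lambda>\<omega>. (v \<omega>)\<^sup>2) = b\<^sup>2"
    using vU vV by (auto simp: a_def b_def u_def v_def)
  have le: "u \<omega> * v \<omega> \<le> (b / (2 * a)) * (u \<omega>)\<^sup>2 + (a / (2 * b)) * (v \<omega>)\<^sup>2" for \<omega>
  proof -
    have "0 \<le> (b * u \<omega> - a * v \<omega>)\<^sup>2 / (2 * a * b)" using ab by simp
    also have "\<dots> = (b / (2 * a)) * (u \<omega>)\<^sup>2 + (a / (2 * b)) * (v \<omega>)\<^sup>2 - u \<omega> * v \<omega>"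
      using ab by (simp add: field_simps power2_eq_square)
    finally show ?thesis by simp
  qed
  have iuv: "integrable M (\<lambda>\<omega>. u \<omega> * v \<omega>)"
  proof (rule Bochner_Integration.integrable_bound)
    show "integrable M (\<lambda>\<omega>. (u \<omega>)\<^sup>2 + (v \<omega>)\<^sup>2)" using iu iv by simp
    have "\<bar>x * y\<bar> \<le> x\<^sup>2 + y\<^sup>2" for x y :: real
      using sum_squares_bound[of "\<bar>x\<bar>" "\<bar>y\<bar>"] abs_ge_zero[of "x * y"]
      unfolding abs_mult power2_abs by linarith
    then show "AE \<omega> in M. norm (u \<omega> * v \<omega>) \<le> norm ((u \<omega>)\<^sup>2 + (v \<omega>)\<^sup>2)"
      by auto
  qed auto
  have "covariance M U V = expectation (\<lambda>\<omega>. u \<omega> * v \<omega>)"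
    by (simp add: covariance_def u_def v_def)
  also have "\<dots> \<le> expectation (\<lambda>\<omega>. (b / (2 * a)) * (u \<omega>)\<^sup>2 + (a / (2 * b)) * (v \<omega>)\<^sup>2)"
    by (rule integral_mono) (use iuv iu iv le in auto)
  also have "\<dots> = (b / (2 * a)) * a\<^sup>2 + (a / (2 * b)) * b\<^sup>2"
    using iu iv a2 b2 by simp
  also have "\<dots> = a * b" using ab by (simp add: field_simps power2_eq_square)
  finally show ?thesis
    using ab by (simp add: a_def b_def real_sqrt_mult)
qed

definition R_hom :: "nat \<Rightarrow> nat \<Rightarrow> nat \<Rightarrow> real \<Rightarrow> real" where
  "R_hom n m l p = (p ^ n - p ^ (m + n - l)) / sqrt (p ^ (m + n - l) * (1 - p ^ m) * (1 - p ^ (n - l)))"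

end

theory Submission
  imports Defs
begin

text \<open>
  Each minimum is almost surely the indicator of the event that all variables involved equal 1.
  A function of an indicator is affine in it, so every quotient in the definition of the maximal
  correlation is plus or minus the ordinary correlation coefficient of the two indicators, and that
  coefficient is non-negative.  In the homogeneous case, with \<open>d = m - l\<close>, the square of the
  coefficient factors into the functions \<open>p ^ (a - d) * (1 - p ^ d) / (1 - p ^ a)\<close> for \<open>a = m\<close> and
  \<open>a = n - l\<close>, each of which is monotone: cancelling \<open>1 - p\<close> turns it into the proportion of the last
  \<open>d\<close> terms in the sum of \<open>p ^ i\<close> over \<open>i < a\<close>.
\<close>

section \<open>Maximal correlation of two indicators\<close>

context prob_space
begin

text \<open>The affine form is required only almost surely, because the Bernoulli hypotheses fix the
  probabilities of the values 0 and 1 and leave other values possible on a null set.\<close>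

lemma expectation_AE_affine_indicator:
  assumes [measurable]: "U \<in> borel_measurable M" "A \<in> events"
    and "AE \<omega> in M. U \<omega> = a + b * indicator A \<omega>"
  shows "expectation U = a + b * prob A"
proof -
  have "expectation U = expectation (\<lambda>\<omega>. a + b * indicator A \<omega>)"
    using assms(3) by (intro integral_cong_AE) auto
  then show ?thesis
    by (simp add: prob_space emeasure_eq_measure)
qed

lemma covariance_AE_affine_indicator:
  assumes [measurable]: "U \<in> borel_measurable M" "V \<in> borel_measurable M" "A \<in> events" "B \<in> events"
    and U: "AE \<omega> in M. U \<omega> = a + b * indicator A \<omega>"
    and V: "AE \<omega> in M. V \<omega> = c + d * indicator B \<omega>"
  shows "covariance M U V = b * d * (prob (A \<inter> B) - prob A * prob B)"
proof -
  note E = expectation_AE_affine_indicator[OF assms(1,3) U] expectation_AE_affine_indicator[OF assms(2,4) V]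
  have "covariance M U V = expectation (\<lambda>\<omega>. b * d * (indicator (A \<inter> B) \<omega>
      - prob B * indicator A \<omega> - prob A * indicator B \<omega> + prob A * prob B))"
    unfolding covariance_def E
  proof (intro integral_cong_AE)
    show "AE \<omega> in M. (U \<omega> - (a + b * prob A)) * (V \<omega> - (c + d * prob B)) =
      b * d * (indicator (A \<inter> B) \<omega> - prob B * indicator A \<omega> - prob A * indicator B \<omega> + prob A * prob B)"
      using U V by eventually_elim (simp add: indicator_inter_arith algebra_simps)
  qed auto
  also have "\<dots> = b * d * (prob (A \<inter> B) - prob A * prob B)"
    by (simp add: prob_space emeasure_eq_measure)
  finally show ?thesis .
qed

lemma variance_AE_affine_indicator:
  assumes "U \<in> borel_measurable M" "A \<in> events"
    and "AE \<omega> in M. U \<omega> = a + b * indicator A \<omega>"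
  shows "variance U = b\<^sup>2 * (prob A * (1 - prob A))"
  using covariance_AE_affine_indicator[OF assms(1,1,2,2,3,3)]
  by (simp add: covariance_def power2_eq_square algebra_simps)

text \<open>This makes the identity functions admissible in the supremum.\<close>

lemma positive_finite_variance_AE_indicator:
  assumes [measurable]: "U \<in> borel_measurable M" "A \<in> events"
    and U: "AE \<omega> in M. U \<omega> = indicator A \<omega>" and "0 < prob A" "prob A < 1"
  shows "positive_finite_variance M U"
proof -
  have "integrable M (\<lambda>\<omega>. (U \<omega>)\<^sup>2)"
  proof (rule integrable_const_bound[where B = 1])
    show "AE \<omega> in M. norm ((U \<omega>)\<^sup>2) \<le> 1"
      using U by eventually_elim (simp add: indicator_def)
  qed auto
  moreover have "variance U = 1\<^sup>2 * (prob A * (1 - prob A))"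
    using U by (intro variance_AE_affine_indicator[where a = 0]) auto
  ultimately show ?thesis
    using assms by (auto simp: positive_finite_variance_def)
qed

text \<open>By \<open>pos\<close> the ordinary correlation is non-negative, so the greatest quotient
  is the one with sign +1, attained when \<phi> and \<psi> are both the identity. A negative
  correlation would instead be exceeded by its absolute value, on replacing \<psi> by its
  negative.\<close>

lemma maximal_correlation_AE_indicator:
  assumes [measurable]: "U \<in> borel_measurable M" "V \<in> borel_measurable M" "A \<in> events" "B \<in> events"
    and U: "AE \<omega> in M. U \<omega> = indicator A \<omega>" and V: "AE \<omega> in M. V \<omega> = indicator B \<omega>"
    and A: "0 < prob A" "prob A < 1" and B: "0 < prob B" "prob B < 1"
    and pos: "prob A * prob B \<le> prob (A \<inter> B)"
  shows "maximal_correlation M U V = (prob (A \<inter> B) - prob A * prob B) /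
    sqrt (prob A * (1 - prob A) * prob B * (1 - prob B))" (is "_ = ?\<rho>")
proof -
  define Q where "Q = (\<lambda>(\<phi> :: real \<Rightarrow> real) (\<psi> :: real \<Rightarrow> real).
    covariance M (\<lambda>\<omega>. \<phi> (U \<omega>)) (\<lambda>\<omega>. \<psi> (V \<omega>)) /
      sqrt (variance (\<lambda>\<omega>. \<phi> (U \<omega>)) * variance (\<lambda>\<omega>. \<psi> (V \<omega>))))"
  have Q: "Q \<phi> \<psi> = sgn ((\<phi> 1 - \<phi> 0) * (\<psi> 1 - \<psi> 0)) * ?\<rho>"
    if [measurable]: "\<phi> \<in> borel_measurable borel" "\<psi> \<in> borel_measurable borel" for \<phi> \<psi>
  proof -
    define b where "b = \<phi> 1 - \<phi> 0"
    define d where "d = \<psi> 1 - \<psi> 0"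
    have 1: "AE \<omega> in M. \<phi> (U \<omega>) = \<phi> 0 + b * indicator A \<omega>"
      using U by eventually_elim (simp add: b_def indicator_def)
    have 2: "AE \<omega> in M. \<psi> (V \<omega>) = \<psi> 0 + d * indicator B \<omega>"
      using V by eventually_elim (simp add: d_def indicator_def)
    have c: "covariance M (\<lambda>\<omega>. \<phi> (U \<omega>)) (\<lambda>\<omega>. \<psi> (V \<omega>)) = b * d * (prob (A \<inter> B) - prob A * prob B)"
      by (rule covariance_AE_affine_indicator[OF _ _ _ _ 1 2]) auto
    have v: "variance (\<lambda>\<omega>. \<phi> (U \<omega>)) * variance (\<lambda>\<omega>. \<psi> (V \<omega>)) =
        (b * d)\<^sup>2 * (prob A * (1 - prob A) * prob B * (1 - prob B))"
      using variance_AE_affine_indicator[OF _ _ 1] variance_AE_affine_indicator[OF _ _ 2]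
      by (simp add: power_mult_distrib)
    \<comment> \<open>The root of \<open>(b * d)\<^sup>2\<close> is the absolute value of
      \<open>b * d\<close>, so only the sign of this factor survives. If it is 0, both sides vanish
      because division by zero yields 0; hence the formula for \<open>Q\<close> covers degenerate
      \<phi> and \<psi> too.\<close>
    have "b * d / \<bar>b * d\<bar> = sgn (b * d)"
      by (simp add: real_sgn_eq)
    then show ?thesis
      unfolding Q_def c v real_sqrt_mult[of "(b * d)\<^sup>2"] real_sqrt_abs b_def[symmetric] d_def[symmetric]
      by (metis times_divide_times_eq)
  qed
  have "?\<rho> \<ge> 0"
    using A B pos by simp
  have "Sup {Q \<phi> \<psi> | \<phi> \<psi>. \<phi> \<in> borel_measurable borel \<and> \<psi> \<in> borel_measurable borel \<and>
                  positive_finite_variance M (\<lambda>\<omega>. \<phi> (U \<omega>)) \<and>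
                  positive_finite_variance M (\<lambda>\<omega>. \<psi> (V \<omega>))} = ?\<rho>"
  proof (rule cSup_eq_maximum)
    show "?\<rho> \<in> {Q \<phi> \<psi> | \<phi> \<psi>. \<phi> \<in> borel_measurable borel \<and> \<psi> \<in> borel_measurable borel \<and>
                  positive_finite_variance M (\<lambda>\<omega>. \<phi> (U \<omega>)) \<and>
                  positive_finite_variance M (\<lambda>\<omega>. \<psi> (V \<omega>))}"
      using positive_finite_variance_AE_indicator[OF _ _ U] positive_finite_variance_AE_indicator[OF _ _ V]
        A B Q[of "\<lambda>x. x" "\<lambda>x. x"]
      by (intro CollectI exI[of _ "\<lambda>x. x"]) simp
  next
    fix x assume "x \<in> {Q \<phi> \<psi> | \<phi> \<psi>. \<phi> \<in> borel_measurable borel \<and> \<psi> \<in> borel_measurable borel \<and>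
                  positive_finite_variance M (\<lambda>\<omega>. \<phi> (U \<omega>)) \<and>
                  positive_finite_variance M (\<lambda>\<omega>. \<psi> (V \<omega>))}"
    then obtain t :: real where "x = sgn t * ?\<rho>"
      using Q by auto
    moreover have "sgn t * ?\<rho> \<le> 1 * ?\<rho>"
      using \<open>?\<rho> \<ge> 0\<close> by (intro mult_right_mono) (auto simp: sgn_if)
    ultimately show "x \<le> ?\<rho>"
      by simp
  qed
  then show ?thesis
    by (simp add: maximal_correlation_def Q_def)
qed

section \<open>Minima of independent Bernoulli variables\<close>

lemma AE_Bernoulli_cases:
  assumes [measurable]: "Z \<in> borel_measurable M"
    and "prob {\<omega> \<in> space M. Z \<omega> = 1} = q" "prob {\<omega> \<in> space M. Z \<omega> = (0::real)} = 1 - q"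
  shows "AE \<omega> in M. Z \<omega> = 0 \<or> Z \<omega> = 1"
proof -
  have "prob ({\<omega> \<in> space M. Z \<omega> = 1} \<union> {\<omega> \<in> space M. Z \<omega> = 0}) = 1"
    using assms(2,3) by (subst finite_measure_Union) auto
  also have "{\<omega> \<in> space M. Z \<omega> = 1} \<union> {\<omega> \<in> space M. Z \<omega> = 0} = {\<omega> \<in> space M. Z \<omega> = 0 \<or> Z \<omega> = 1}"
    by auto
  finally show ?thesis
    by (subst (asm) prob_Collect_eq_1) auto
qed

lemma prob_all_eq_indep_vars:
  fixes X :: "'i \<Rightarrow> 'a \<Rightarrow> real"
  assumes "indep_vars (\<lambda>_. borel) X I" "J \<subseteq> I" "finite J" "J \<noteq> {}"
  shows "prob {\<omega> \<in> space M. \<forall>i\<in>J. X i \<omega> = c} = (\<Prod>i\<in>J. prob {\<omega> \<in> space M. X i \<omega> = c})"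
proof -
  have "prob (\<Inter>i\<in>J. X i -` {c} \<inter> space M) = (\<Prod>i\<in>J. prob (X i -` {c} \<inter> space M))"
    using assms by (intro indep_varsD) auto
  \<comment> \<open>An empty intersection would be \<open>UNIV\<close> rather than
    \<open>space M\<close>.\<close>
  moreover have "(\<Inter>i\<in>J. X i -` {c} \<inter> space M) = {\<omega> \<in> space M. \<forall>i\<in>J. X i \<omega> = c}"
    using \<open>J \<noteq> {}\<close> by auto
  moreover have "X i -` {c} \<inter> space M = {\<omega> \<in> space M. X i \<omega> = c}" for i
    by auto
  ultimately show ?thesis
    by simp
qed

lemma AE_Min_eq_indicator:
  fixes X :: "'i \<Rightarrow> 'a \<Rightarrow> real"
  assumes J: "finite J" "J \<noteq> {}" and "\<And>i. i \<in> J \<Longrightarrow> AE \<omega> in M. X i \<omega> = 0 \<or> X i \<omega> = 1"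
  shows "AE \<omega> in M. (MIN i\<in>J. X i \<omega>) = indicator {\<omega> \<in> space M. \<forall>i\<in>J. X i \<omega> = 1} \<omega>"
proof -
  have "AE \<omega> in M. \<forall>i\<in>J. X i \<omega> = 0 \<or> X i \<omega> = 1"
    using assms by (intro AE_finite_allI) auto
  then show ?thesis
    using AE_space
  proof eventually_elim
    case (elim \<omega>)
    show ?case
    proof (cases "\<forall>i\<in>J. X i \<omega> = 1")
      case True
      then have "(\<lambda>i. X i \<omega>) ` J = {1}"
        using J by auto
      with True elim show ?thesis
        by simp
    next
      case False
      with elim have "(MIN i\<in>J. X i \<omega>) = 0"
        by (intro Min_eqI) (use J in force)+
      with False show ?thesis
        by auto
    qed
  qed
qed

end

lemma prod_unit_interval:
  fixes p :: "'i \<Rightarrow> real"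
  assumes "finite J" "J \<noteq> {}" "\<And>i. i \<in> J \<Longrightarrow> 0 < p i \<and> p i < 1"
  shows "0 < prod p J" "prod p J < 1"
proof -
  show "0 < prod p J"
    using assms by (intro prod_pos) auto
  obtain i where "i \<in> J"
    using assms by auto
  then have "prod p J < (\<Prod>i\<in>J. 1)"
    using assms by (intro prod_mono_strict[of i]) (auto intro: less_imp_le)
  then show "prod p J < 1"
    by simp
qed

lemma maximal_correlation_Min_Bernoulli:
  fixes X :: "'i \<Rightarrow> 'a \<Rightarrow> real" and p :: "'i \<Rightarrow> real"
  assumes "prob_space M" and ind: "prob_space.indep_vars M (\<lambda>_. borel) X (I \<union> J)"
    and p: "\<And>i. i \<in> I \<union> J \<Longrightarrow> 0 < p i \<and> p i < 1 \<and> prob_space.prob M {\<omega> \<in> space M. X i \<omega> = 1} = p i \<and>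
         prob_space.prob M {\<omega> \<in> space M. X i \<omega> = 0} = 1 - p i"
    and fin: "finite I" "I \<noteq> {}" "finite J" "J \<noteq> {}"
  shows "maximal_correlation M (\<lambda>\<omega>. MIN i\<in>I. X i \<omega>) (\<lambda>\<omega>. MIN j\<in>J. X j \<omega>) =
    (prod p (I \<union> J) - prod p I * prod p J) /
      sqrt (prod p I * (1 - prod p I) * prod p J * (1 - prod p J))"
proof -
  interpret prob_space M by fact
  have X [measurable]: "X i \<in> borel_measurable M" if "i \<in> I \<union> J" for i
    using ind that by (auto simp: indep_vars_def)
  \<comment> \<open>Keeping \<open>K\<close> general lets one set of facts serve both minima and
    also their joint event, which is \<open>E (I \<union> J)\<close>.\<close>
  define E where "E K = {\<omega> \<in> space M. \<forall>i\<in>K. X i \<omega> = 1}" for K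
  have E: "E K \<in> events" "prob (E K) = prod p K"
    "(\<lambda>\<omega>. MIN i\<in>K. X i \<omega>) \<in> borel_measurable M" "AE \<omega> in M. (MIN i\<in>K. X i \<omega>) = indicator (E K) \<omega>"
    if K: "K \<subseteq> I \<union> J" "K \<noteq> {}" for K
  proof -
    have fK: "finite K"
      using K fin by (auto intro: finite_subset)
    have [measurable]: "X i \<in> borel_measurable M" if "i \<in> K" for i
      using X K that by blast
    show "E K \<in> events"
      unfolding E_def using fK by measurable
    show "prob (E K) = prod p K"
      unfolding E_def prob_all_eq_indep_vars[OF ind K(1) fK K(2)] using p K by (intro prod.cong) auto
    show "(\<lambda>\<omega>. MIN i\<in>K. X i \<omega>) \<in> borel_measurable M"
      using fK by (intro borel_measurable_Min) auto
    show "AE \<omega> in M. (MIN i\<in>K. X i \<omega>) = indicator (E K) \<omega>"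
      unfolding E_def
    proof (rule AE_Min_eq_indicator[OF fK K(2)])
      fix i assume "i \<in> K"
      then show "AE \<omega> in M. X i \<omega> = 0 \<or> X i \<omega> = 1"
        using p K by (intro AE_Bernoulli_cases[where q = "p i"]) auto
    qed
  qed
  have "E I \<inter> E J = E (I \<union> J)"
    by (auto simp: E_def)
  then have int: "prob (E I \<inter> E J) = prod p (I \<union> J)"
    using E(2) fin by simp
  \<comment> \<open>Non-negative covariance: the shared indices are counted twice in the product of
    the marginals, and the surplus factor is at most 1.\<close>
  have "prod p (I \<union> J) * prod p (I \<inter> J) = prod p I * prod p J"
    using fin by (simp add: prod.union_inter)
  moreover have "prod p (I \<inter> J) \<le> 1" "0 \<le> prod p (I \<union> J)"
    using p by (auto intro!: prod_le_1 prod_nonneg intro: less_imp_le)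
  ultimately have "prod p I * prod p J \<le> prod p (I \<union> J)"
    by (metis mult_left_le)
  moreover have "0 < prod p K \<and> prod p K < 1" if "K = I \<or> K = J" for K
    using prod_unit_interval[of K p] p fin that by auto
  ultimately show ?thesis
    using maximal_correlation_AE_indicator[of "\<lambda>\<omega>. MIN i\<in>I. X i \<omega>" "\<lambda>\<omega>. MIN j\<in>J. X j \<omega>" "E I" "E J"]
      E[of I] E[of J] int fin by simp
qed

section \<open>Monotonicity in the homogeneous case\<close>

lemma mono_on_tail_ratio:
  assumes "d \<le> a"
  shows "mono_on {0<..<1} (\<lambda>p::real. p ^ (a - d) * (1 - p ^ d) / (1 - p ^ a))"
proof (cases "a = 0")
  case True
  then show ?thesis by (auto simp: mono_on_def)
next
  case False
  define k where "k = a - d"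
  \<comment> \<open>\<open>H\<close> is the head and \<open>T\<close> the tail, of \<open>d\<close>
    terms, of the geometric sum of length \<open>a\<close>.\<close>
  define H where "H = (\<lambda>p::real. \<Sum>i<k. p ^ i)"
  define T where "T = (\<lambda>p::real. \<Sum>j\<in>{k..<a}. p ^ j)"
  have H: "H p * (1 - p) = 1 - p ^ k" for p
    by (simp add: H_def one_diff_power_eq mult.commute)
  have HT: "H p + T p = (\<Sum>i<a. p ^ i)" for p
    unfolding H_def T_def using sum.atLeastLessThan_concat[of 0 k a "\<lambda>i. p ^ i"]
    by (simp add: k_def atLeast0LessThan)
  have HTp: "H p + T p > 0" if "0 < p" for p
    unfolding HT using that False by (intro sum_pos) auto
  have eq: "p ^ k * (1 - p ^ d) / (1 - p ^ a) = T p / (H p + T p)" if "p \<in> {0<..<1}" for p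
  proof -
    have 1: "(H p + T p) * (1 - p) = 1 - p ^ a"
      by (simp add: HT one_diff_power_eq mult.commute)
    have "k + d = a"
      using assms by (simp add: k_def)
    then have "p ^ k * (1 - p ^ d) = T p * (1 - p)"
      using H[of p] 1 by (auto simp: algebra_simps simp flip: power_add)
    then show ?thesis
      using that unfolding 1[symmetric] by simp
  qed
  \<comment> \<open>After cross-multiplication the terms \<open>T p * T q\<close> cancel, leaving
    \<open>T p * H q \<le> T q * H p\<close>. This holds term by term, since every exponent in the
    tail exceeds every exponent in the head.\<close>
  have "T p / (H p + T p) \<le> T q / (H q + T q)" if "0 < p" "p \<le> q" for p q
  proof -
    have "T p * H q = (\<Sum>j\<in>{k..<a}. \<Sum>i<k. p ^ j * q ^ i)"
      by (simp add: T_def H_def sum_product)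
    also have "\<dots> \<le> (\<Sum>j\<in>{k..<a}. \<Sum>i<k. q ^ j * p ^ i)"
    proof (intro sum_mono)
      fix i j assume "j \<in> {k..<a}" "i \<in> {..<k}"
      then have j: "j = (j - i) + i" by simp
      have "p ^ (j - i) * (p ^ i * q ^ i) \<le> q ^ (j - i) * (p ^ i * q ^ i)"
        using that by (intro mult_right_mono power_mono) auto
      then show "p ^ j * q ^ i \<le> q ^ j * p ^ i"
        by (subst (1 2) j) (simp only: power_add mult_ac)
    qed
    also have "\<dots> = T q * H p"
      by (simp add: T_def H_def sum_product)
    finally show ?thesis
      using HTp[of p] HTp[of q] that by (simp add: divide_simps algebra_simps)
  qed
  then show ?thesis
    unfolding k_def[symmetric] by (auto intro!: mono_onI simp: eq)
qed

text \<open>With \<open>d = m - l\<close> and \<open>r = n - m\<close>, the numerator is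
  \<open>p ^ (l + d + r) * (1 - p ^ d)\<close>. Squaring it and dividing by
  \<open>p ^ (l + 2 * d + r)\<close> leaves \<open>p ^ (l + r)\<close>, whose two parts go to the
  two factors.\<close>

lemma R_hom_eq_sqrt:
  assumes "l \<le> m" "m \<le> n" "0 < p" "p < 1"
  shows "R_hom n m l p = sqrt ((p ^ (m - (m - l)) * (1 - p ^ (m - l)) / (1 - p ^ m)) *
    (p ^ (n - l - (m - l)) * (1 - p ^ (m - l)) / (1 - p ^ (n - l))))"
proof -
  define d where "d = m - l"
  define r where "r = n - m"
  have ml: "m - l = d" "m - d = l" "n - l = d + r"
    "m + n - l = l + 2 * d + r" and n: "n = l + d + r"
    using assms by (auto simp: d_def r_def)
  have pd: "p ^ d \<le> 1"
    using assms by (intro power_le_one) auto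
  \<comment> \<open>The numerator is non-negative, so it can be moved under the root.\<close>
  have num: "p ^ n - p ^ (m + n - l) = sqrt ((p ^ (l + d + r) * (1 - p ^ d))\<^sup>2)"
    using \<open>0 < p\<close> pd unfolding ml unfolding n mult_2 power_add by (simp add: abs_mult algebra_simps)
  have "(p ^ (l + d + r) * (1 - p ^ d))\<^sup>2 / (p ^ (l + 2 * d + r) * (1 - p ^ m) * (1 - p ^ (n - l))) =
    p ^ l * (1 - p ^ d) / (1 - p ^ m) * (p ^ r * (1 - p ^ d) / (1 - p ^ (n - l)))"
    using \<open>0 < p\<close> by (simp add: power_add power2_eq_square mult_2 divide_simps)
  then show ?thesis
    unfolding R_hom_def num real_sqrt_divide[symmetric]
    unfolding ml by simp
qed

lemma mono_on_R_hom:
  assumes "l \<le> m" "m \<le> n"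
  shows "mono_on {0<..<1} (R_hom n m l)"
proof (rule mono_onI)
  fix p q :: real
  assume pq: "p \<in> {0<..<1}" "q \<in> {0<..<1}" "p \<le> q"
  define f where "f a x = x ^ (a - (m - l)) * (1 - x ^ (m - l)) / (1 - x ^ a)" for a and x :: real
  have "f a p \<le> f a q" if "m - l \<le> a" for a
    unfolding f_def using mono_onD[OF mono_on_tail_ratio[OF that] pq] .
  \<comment> \<open>Non-negativity allows the inequalities for the two factors to be
    multiplied.\<close>
  moreover have "0 \<le> f a x" if "x \<in> {0<..<1}" for a x
    unfolding f_def using that by (intro divide_nonneg_nonneg mult_nonneg_nonneg) (auto intro: power_le_one)
  moreover have "R_hom n m l x = sqrt (f m x * f (n - l) x)" if "x \<in> {0<..<1}" for x
    unfolding f_def using that assms by (intro R_hom_eq_sqrt) auto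
  ultimately show "R_hom n m l p \<le> R_hom n m l q"
    using pq assms by (simp add: mult_mono)
qed

theorem theorem1p3:
  fixes n m l :: nat
  assumes "1 \<le> l + 1" and "l + 1 \<le> m" and "m \<le> n"
  shows "(\<forall>(M :: 'a measure) (X :: nat \<Rightarrow> 'a \<Rightarrow> real) (p :: nat \<Rightarrow> real) (R :: real).
      prob_space M \<longrightarrow>
      prob_space.indep_vars M (\<lambda>_. borel) X {1..n} \<longrightarrow>
      (\<forall>i\<in>{1..n}. 0 < p i \<and> p i < 1 \<and>
         prob_space.prob M {\<omega> \<in> space M. X i \<omega> = 1} = p i \<and>
         prob_space.prob M {\<omega> \<in> space M. X i \<omega> = 0} = 1 - p i) \<longrightarrow>
      R = maximal_correlation M (\<lambda>\<omega>. MIN i\<in>{1..m}. X i \<omega>) (\<lambda>\<omega>. MIN j\<in>{l+1..n}. X j \<omega>) \<longrightarrow>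
        R = ((\<Prod>i=1..n. p i) - (\<Prod>i=1..m. p i) * (\<Prod>i=l+1..n. p i)) /
              sqrt ((\<Prod>i=1..m. p i) * (1 - (\<Prod>i=1..m. p i)) *
                    (\<Prod>i=l+1..n. p i) * (1 - (\<Prod>i=l+1..n. p i))) \<and>
        (\<forall>q::real. 0 < q \<and> q < 1 \<and> (\<forall>i\<in>{1..n}. p i = q) \<longrightarrow> R = R_hom n m l q)) \<and>
    mono_on {0<..<1} (R_hom n m l)"
proof (intro conjI allI impI, goal_cases)
  \<comment> \<open>The two ranges leave no gap, so the joint event involves all \<open>n\<close>
    variables.\<close>
  have U: "{1..m} \<union> {l+1..n} = {1..n}"
    using assms by auto
  note formula = maximal_correlation_Min_Bernoulli[of _ _ "{1..m}" "{l+1..n}", unfolded U]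
  {
    case (1 M X p R)
    then show ?case
      using formula[of M X p] assms by simp
  next
    case (2 M X p R q)
    have const: "prod p K = q ^ card K" if "K \<subseteq> {1..n}" for K
    proof -
      have "prod p K = (\<Prod>i\<in>K. q)"
        using 2 that by (intro prod.cong) auto
      then show ?thesis by simp
    qed
    have pr: "prod p {1..n} = q ^ n" "prod p {1..m} = q ^ m" "prod p {l+1..n} = q ^ (n - l)"
      using const[of "{1..n}"] const[of "{1..m}"] const[of "{l+1..n}"] assms by auto
    \<comment> \<open>Valid for truncated subtraction because \<open>l \<le> n\<close>; it lets
      \<open>power_add\<close> split the exponent into those of the two minima.\<close>
    have mn: "m + n - l = m + (n - l)"
      using assms by simp
    have "R = (q ^ n - q ^ m * q ^ (n - l)) / sqrt (q ^ m * (1 - q ^ m) * q ^ (n - l) * (1 - q ^ (n - l)))"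
      using 2 formula[of M X p] assms unfolding pr by simp
    then show ?case
      unfolding R_hom_def mn power_add by (simp add: mult_ac)
  }
  case 3
  show ?case
    using assms by (intro mono_on_R_hom) auto
qed

end
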